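(* Let $\rho:\mathfrak{n}(n)\to\mathfrak{gl}(n)$ be the standard representation (on $\mathbb{C}^n$) of the Lie algebra $\mathfrak{n}(n)$ of strictly upper triangular $n\times n$ complex matrices. Then the Jordan--Kronecker invariants of $\rho$ are: - $\frac{(n-1)(n-2)}{2}$ horizontal indices: $1$ taken $\frac{(n-3)(n-2)}{2}$ times and $2$ taken $n-2$ times; - one Jordan $1\times1$ block; - one vertical index $\mathrm{v}_1=1$.
   Context: Everything is over $\mathbb{C}$ and finite-dimensional. Pencils. For linear maps $A,B:U\to V$ there are bases of $U$ and $V$ (Kronecker's theorem) in which all matrices $A+\lambda B$ are simultaneously block-diagonal, each pair of diagonal blocks $(A_i,B_i)$ being one of: (i) a $k\times k$ Jordan block with eigenvalue $\lambda_0\in\mathbb{C}$: $A_i=J_k(\lambda_0)$ (the upper triangular Jordan block), $B_i=I_k$; (ii) a $k\times k$ Jordan block with eigenvalue $\infty$: $A_i=I_k$, $B_i=J_k(0)$; (iii) a horizontal Kronecker block of size $(h-1)\times h$, $h\ge 1$: $A_i=(0\,|\,I_{h-1})$, $B_i=(I_{h-1}\,|\,0)$; (iv) a vertical Kronecker block of size $v\times(v-1)$, $v\ge1$: the transposes of the matrices in (iii) with $h=v$. A $0\times 1$ horizontal block ($h=1$) is a zero column and a $1\times 0$ vertical block ($v=1$) is a zero row. The blocks are unique up to permutation. The numbers $h$ (widths of horizontal blocks) are the horizontal indices, the numbers $v$ (heights of vertical blocks) are the vertical indices. Representations. For a representation $\rho:\mathfrak{g}\to\mathfrak{gl}(V)$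 and $x\in V$ put $R_x:\mathfrak{g}\to V$, $R_x(\xi)=\rho(\xi)x$. The algebraic type of the pencil $R_a+\lambda R_b=R_{a+\lambda b}$ is the collection: number of distinct eigenvalues of Jordan blocks, number and sizes of the Jordan blocks for each eigenvalue, horizontal and vertical indices (with multiplicity). The Jordan--Kronecker (JK) invariants of $\rho$ are the algebraic type of $R_{a+\lambda b}$ for a generic pair $(a,b)\in V\times V$ (i.e. for all pairs in some non-empty Zariski open subset). *)

theory Defs
  imports "Jordan_Normal_Form.Jordan_Normal_Form" "Jordan_Normal_Form.VS_Connect"
    "HOL-Library.Multiset"
begin

section \<open>Pencils and the Kronecker canonical form\<close>

text \<open>The eigenvalue of a Jordan block lies in the projective line: \<^term>\<open>Some c\<close> is the finite
  eigenvalue \<^term>\<open>c\<close>, and \<^term>\<open>None\<close> is the eigenvalue at infinity. The argument of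
  \<open>Horizontal\<close> is the width of the block, that of \<open>Vertical\<close> is its height.\<close>

datatype kronecker_block =
    Jordan "complex option" nat
  | Horizontal nat
  | Vertical nat

text \<open>All sizes are at least 1. Horizontal blocks of width 1 have no rows and vertical blocks of
  height 1 have no columns: they contribute a zero column or a zero row to the block-diagonal
  matrix, which \<^const>\<open>diag_block_mat\<close> supports.\<close>

fun valid_block :: "kronecker_block \<Rightarrow> bool" where
  "valid_block (Jordan e k) \<longleftrightarrow> k \<ge> 1"
| "valid_block (Horizontal h) \<longleftrightarrow> h \<ge> 1"
| "valid_block (Vertical v) \<longleftrightarrow> v \<ge> 1"

text \<open>The matrices \<open>(0 | I)\<close> and \<open>(I | 0)\<close> of size \<open>(h - 1) \<times> h\<close>.\<close>

definition zero_id_mat :: "nat \<Rightarrow> complex mat" where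
  "zero_id_mat h = mat (h - 1) h (\<lambda>(i, j). if j = i + 1 then 1 else 0)"

definition id_zero_mat :: "nat \<Rightarrow> complex mat" where
  "id_zero_mat h = mat (h - 1) h (\<lambda>(i, j). if j = i then 1 else 0)"

fun block_A :: "kronecker_block \<Rightarrow> complex mat" where
  "block_A (Jordan (Some c) k) = jordan_block k c"
| "block_A (Jordan None k) = 1\<^sub>m k"
| "block_A (Horizontal h) = zero_id_mat h"
| "block_A (Vertical v) = transpose_mat (zero_id_mat v)"

fun block_B :: "kronecker_block \<Rightarrow> complex mat" where
  "block_B (Jordan (Some c) k) = 1\<^sub>m k"
| "block_B (Jordan None k) = jordan_block k 0"
| "block_B (Horizontal h) = id_zero_mat h"
| "block_B (Vertical v) = transpose_mat (id_zero_mat v)"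

text \<open>The component \<open>jordan_sizes\<close> has one element for each distinct eigenvalue, namely the multiset
  of the sizes of the Jordan blocks with that eigenvalue. The eigenvalues themselves are not part
  of the algebraic type.\<close>

record algebraic_type =
  jordan_sizes :: "nat multiset multiset"
  horizontal_indices :: "nat multiset"
  vertical_indices :: "nat multiset"

definition type_of_blocks :: "kronecker_block list \<Rightarrow> algebraic_type" where
  "type_of_blocks bs = \<lparr>
     jordan_sizes = image_mset (\<lambda>e. mset [k. Jordan e' k \<leftarrow> bs, e' = e])
                      (mset_set {e. \<exists>k. Jordan e k \<in> set bs}),
     horizontal_indices = mset [h. Horizontal h \<leftarrow> bs],
     vertical_indices = mset [v. Vertical v \<leftarrow> bs]\<rparr>"

definition ordered_basis :: "(complex, 'v) module \<Rightarrow> 'v list \<Rightarrow> bool" where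
  "ordered_basis V vs \<longleftrightarrow> distinct vs \<and> vectorspace.basis class_ring V (set vs)"

definition is_matrix_of ::
  "(complex, 'v) module \<Rightarrow> 'u list \<Rightarrow> 'v list \<Rightarrow> ('u \<Rightarrow> 'v) \<Rightarrow> complex mat \<Rightarrow> bool" where
  "is_matrix_of V us vs f M \<longleftrightarrow>
     M \<in> carrier_mat (length vs) (length us) \<and>
     (\<forall>j < length us. f (us ! j) = (\<Oplus>\<^bsub>V\<^esub>i\<in>{..<length vs}. M $$ (i, j) \<odot>\<^bsub>V\<^esub> (vs ! i)))"

text \<open>Since the blocks of the Kronecker canonical form are unique up to permutation, a pencil
  \<open>A + \<lambda> B\<close> has exactly one algebraic type. The existence of the bases forces both spaces to be
  finite-dimensional.\<close>

definition has_algebraic_type ::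
  "(complex, 'u) module \<Rightarrow> (complex, 'v) module \<Rightarrow> ('u \<Rightarrow> 'v) \<Rightarrow> ('u \<Rightarrow> 'v) \<Rightarrow> algebraic_type \<Rightarrow> bool"
where
  "has_algebraic_type U V A B T \<longleftrightarrow>
     linear_map class_ring U V A \<and> linear_map class_ring U V B \<and>
     (\<exists>us vs bs. ordered_basis U us \<and> ordered_basis V vs \<and> list_all valid_block bs \<and>
        is_matrix_of V us vs A (diag_block_mat (map block_A bs)) \<and>
        is_matrix_of V us vs B (diag_block_mat (map block_B bs)) \<and>
        T = type_of_blocks bs)"


section \<open>Zariski open sets\<close>

text \<open>The algebra of polynomial functions on a finite-dimensional vector space is generated by the
  constants and the linear functionals. Only the values on the carrier matter.\<close>

inductive_set polynomial_functions :: "(complex, 'v) module \<Rightarrow> ('v \<Rightarrow> complex) set"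
  for W :: "(complex, 'v) module" where
  const: "(\<lambda>_. c) \<in> polynomial_functions W"
| linear: "(\<forall>x\<in>carrier W. \<forall>y\<in>carrier W. f (x \<oplus>\<^bsub>W\<^esub> y) = f x + f y) \<Longrightarrow>
    (\<forall>c. \<forall>x\<in>carrier W. f (c \<odot>\<^bsub>W\<^esub> x) = c * f x) \<Longrightarrow> f \<in> polynomial_functions W"
| add: "p \<in> polynomial_functions W \<Longrightarrow> q \<in> polynomial_functions W \<Longrightarrow>
    (\<lambda>x. p x + q x) \<in> polynomial_functions W"
| mult: "p \<in> polynomial_functions W \<Longrightarrow> q \<in> polynomial_functions W \<Longrightarrow>
    (\<lambda>x. p x * q x) \<in> polynomial_functions W"

definition zariski_open :: "(complex, 'v) module \<Rightarrow> 'v set \<Rightarrow> bool" where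
  "zariski_open W X \<longleftrightarrow>
     (\<exists>P \<subseteq> polynomial_functions W. X = {x \<in> carrier W. \<exists>p\<in>P. p x \<noteq> 0})"

definition holds_generically :: "(complex, 'v) module \<Rightarrow> ('v \<Rightarrow> bool) \<Rightarrow> bool" where
  "holds_generically W Q \<longleftrightarrow> (\<exists>X. zariski_open W X \<and> X \<noteq> {} \<and> (\<forall>x\<in>X. Q x))"


section \<open>Jordan--Kronecker invariants of representations\<close>

locale lie_algebra = vectorspace "class_ring :: complex ring" L
  for L :: "(complex, 'g) module" (structure) +
  fixes bracket :: "'g \<Rightarrow> 'g \<Rightarrow> 'g"
  assumes bracket_linear_left: "y \<in> carrier L \<Longrightarrow> linear_map class_ring L L (\<lambda>x. bracket x y)"
    and bracket_linear_right: "x \<in> carrier L \<Longrightarrow> linear_map class_ring L L (bracket x)"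
    and bracket_alternating: "x \<in> carrier L \<Longrightarrow> bracket x x = \<zero>"
    and jacobi: "x \<in> carrier L \<Longrightarrow> y \<in> carrier L \<Longrightarrow> z \<in> carrier L \<Longrightarrow>
      bracket x (bracket y z) \<oplus> bracket y (bracket z x) \<oplus> bracket z (bracket x y) = \<zero>"

text \<open>A representation \<open>\<rho> : L \<rightarrow> gl(V)\<close> is given in curried form.\<close>

locale lie_representation = lie_algebra L bracket
  for L :: "(complex, 'g) module" and bracket +
  fixes V :: "(complex, 'v) module" and \<rho> :: "'g \<Rightarrow> 'v \<Rightarrow> 'v"
  assumes \<rho>_linear: "\<xi> \<in> carrier L \<Longrightarrow> linear_map class_ring V V (\<rho> \<xi>)"
    and \<rho>_linear_arg: "x \<in> carrier V \<Longrightarrow> linear_map class_ring L V (\<lambda>\<xi>. \<rho> \<xi> x)"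
    and \<rho>_bracket: "\<xi> \<in> carrier L \<Longrightarrow> \<eta> \<in> carrier L \<Longrightarrow> x \<in> carrier V \<Longrightarrow>
      \<rho> (bracket \<xi> \<eta>) x = \<rho> \<xi> (\<rho> \<eta> x) \<ominus>\<^bsub>V\<^esub> \<rho> \<eta> (\<rho> \<xi> x)"

definition R_map :: "('g \<Rightarrow> 'v \<Rightarrow> 'v) \<Rightarrow> 'v \<Rightarrow> 'g \<Rightarrow> 'v" where
  "R_map \<rho> x = (\<lambda>\<xi>. \<rho> \<xi> x)"

text \<open>The invariants depend only on the linear data of the representation, not on the bracket.
  They are unique: two non-empty Zariski open sets intersect, and each pencil has one
  algebraic type.\<close>

definition has_JK_invariants ::
  "(complex, 'g) module \<Rightarrow> (complex, 'v) module \<Rightarrow> ('g \<Rightarrow> 'v \<Rightarrow> 'v) \<Rightarrow> algebraic_type \<Rightarrow> bool" where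
  "has_JK_invariants L V \<rho> T \<longleftrightarrow>
     holds_generically (direct_sum V V)
       (\<lambda>(a, b). has_algebraic_type L V (R_map \<rho> a) (R_map \<rho> b) T)"


section \<open>Strictly upper triangular matrices and their standard representation\<close>

definition strictly_upper_mats :: "nat \<Rightarrow> complex mat set" where
  "strictly_upper_mats n = {X \<in> carrier_mat n n. \<forall>i<n. \<forall>j\<le>i. X $$ (i, j) = 0}"

definition n_alg :: "nat \<Rightarrow> (complex, complex mat) module" where
  "n_alg n = (module_mat TYPE(complex) n n)\<lparr>carrier := strictly_upper_mats n\<rparr>"

definition commutator :: "complex mat \<Rightarrow> complex mat \<Rightarrow> complex mat" where
  "commutator X Y = X * Y - Y * X"

definition standard_rep :: "complex mat \<Rightarrow> complex vec \<Rightarrow> complex vec" where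
  "standard_rep \<xi> x = \<xi> *\<^sub>v x"

lemma strictly_upper_mats_carrier: "X \<in> strictly_upper_mats n \<Longrightarrow> X \<in> carrier_mat n n"
  by (simp add: strictly_upper_mats_def)

lemma strictly_upper_mats_mult:
  assumes "X \<in> strictly_upper_mats n" "Y \<in> strictly_upper_mats n"
  shows "X * Y \<in> strictly_upper_mats n"
proof -
  have X: "X \<in> carrier_mat n n" and Y: "Y \<in> carrier_mat n n"
    using assms by (auto simp: strictly_upper_mats_def)
  have "(X * Y) $$ (i, j) = 0" if "i < n" "j \<le> i" for i j
  proof -
    have "(X * Y) $$ (i, j) = (\<Sum>k\<in>{0..<n}. X $$ (i, k) * Y $$ (k, j))"
      using X Y that by (simp add: scalar_prod_def)
    also have "\<dots> = 0"
    proof (rule sum.neutral, rule ballI)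
      fix k assume "k \<in> {0..<n}"
      then show "X $$ (i, k) * Y $$ (k, j) = 0"
        using assms that by (cases "k \<le> i") (auto simp: strictly_upper_mats_def)
    qed
    finally show ?thesis .
  qed
  then show ?thesis using X Y by (auto simp: strictly_upper_mats_def)
qed

lemma strictly_upper_mats_commutator:
  assumes "X \<in> strictly_upper_mats n" "Y \<in> strictly_upper_mats n"
  shows "commutator X Y \<in> strictly_upper_mats n"
proof -
  have "A - B \<in> strictly_upper_mats n"
    if "A \<in> strictly_upper_mats n" "B \<in> strictly_upper_mats n" for A B
    using that by (auto simp: strictly_upper_mats_def)
  then show ?thesis
    unfolding commutator_def using assms by (blast intro: strictly_upper_mats_mult)
qed

lemma vectorspace_n_alg: "vectorspace class_ring (n_alg n)"
proof -
  interpret vectorspace "class_ring :: complex ring" "module_mat TYPE(complex) n n"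
    by (rule matrix_vs)
  have "submodule class_ring (strictly_upper_mats n) (module_mat TYPE(complex) n n)"
    by (unfold_locales) (auto simp: module_mat_simps strictly_upper_mats_def)
  then have "subspace class_ring (strictly_upper_mats n) (module_mat TYPE(complex) n n)"
    by (simp add: VectorSpace.subspace_def vectorspace_axioms)
  then show ?thesis unfolding n_alg_def by (rule subspace_is_vs)
qed

lemma n_alg_simps:
  "carrier (n_alg n) = strictly_upper_mats n"
  "add (n_alg n) = (+)" "zero (n_alg n) = 0\<^sub>m n n" "module.smult (n_alg n) = (\<cdot>\<^sub>m)"
  by (simp_all add: n_alg_def module_mat_simps)

lemma linear_mapI:
  assumes "vectorspace class_ring U" "vectorspace class_ring V"
    and "\<And>x. x \<in> carrier U \<Longrightarrow> f x \<in> carrier V"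
    and "\<And>x y. x \<in> carrier U \<Longrightarrow> y \<in> carrier U \<Longrightarrow> f (x \<oplus>\<^bsub>U\<^esub> y) = f x \<oplus>\<^bsub>V\<^esub> f y"
    and "\<And>c x. x \<in> carrier U \<Longrightarrow> f (c \<odot>\<^bsub>U\<^esub> x) = c \<odot>\<^bsub>V\<^esub> f x"
  shows "linear_map (class_ring :: complex ring) U V f"
  using assms
  by (auto simp: linear_map_def mod_hom_def mod_hom_axioms_def module_hom_def vectorspace_def)

lemma commutator_linear:
  assumes "X \<in> carrier_mat n n" "Y \<in> carrier_mat n n" "Z \<in> carrier_mat n n"
  shows "commutator (X + Y) Z = commutator X Z + commutator Y Z"
    and "commutator Z (X + Y) = commutator Z X + commutator Z Y"
    and "commutator (c \<cdot>\<^sub>m X) Z = c \<cdot>\<^sub>m commutator X Z"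
    and "commutator Z (c \<cdot>\<^sub>m X) = c \<cdot>\<^sub>m commutator Z X"
proof -
  note [simp] = add_mult_distrib_mat[of _ n n _ _ n] mult_add_distrib_mat[of _ n n _ n]
    mult_smult_distrib[of _ n n _ n] mult_smult_assoc_mat[of _ n n _ n]
  note [simp del] = index_mult_mat(1)
  show "commutator (X + Y) Z = commutator X Z + commutator Y Z"
    and "commutator Z (X + Y) = commutator Z X + commutator Z Y"
    and "commutator (c \<cdot>\<^sub>m X) Z = c \<cdot>\<^sub>m commutator X Z"
    and "commutator Z (c \<cdot>\<^sub>m X) = c \<cdot>\<^sub>m commutator Z X"
    unfolding commutator_def using assms
    by (intro eq_matI; simp add: carrier_matD index_mult_mat(2,3); simp add: algebra_simps)+
qed

lemma commutator_jacobi: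
  assumes "X \<in> carrier_mat n n" "Y \<in> carrier_mat n n" "Z \<in> carrier_mat n n"
  shows "commutator X (commutator Y Z) + commutator Y (commutator Z X)
    + commutator Z (commutator X Y) = 0\<^sub>m n n"
proof -
  note [simp] = minus_mult_distrib_mat[of _ n n _ _ n] mult_minus_distrib_mat[of _ n n _ n]
    assoc_mult_mat[of _ n n _ n _ n]
  note [simp del] = index_mult_mat(1)
  show ?thesis
    unfolding commutator_def using assms
    by (intro eq_matI; simp add: carrier_matD index_mult_mat(2,3))
qed

lemma lie_representation_standard:
  "lie_representation (n_alg n) commutator (module_vec TYPE(complex) n) standard_rep"
proof (intro lie_representation.intro lie_algebra.intro lie_algebra_axioms.intro
    lie_representation_axioms.intro vectorspace_n_alg)
  fix y assume "y \<in> carrier (n_alg n)"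
  then show "linear_map class_ring (n_alg n) (n_alg n) (\<lambda>x. commutator x y)"
    by (intro linear_mapI vectorspace_n_alg)
      (auto simp: n_alg_simps strictly_upper_mats_commutator commutator_linear[of _ n]
        dest!: strictly_upper_mats_carrier)
next
  fix x assume "x \<in> carrier (n_alg n)"
  then show "linear_map class_ring (n_alg n) (n_alg n) (commutator x)"
    by (intro linear_mapI vectorspace_n_alg)
      (auto simp: n_alg_simps strictly_upper_mats_commutator commutator_linear[of _ n]
        dest!: strictly_upper_mats_carrier)
next
  fix x assume "x \<in> carrier (n_alg n)"
  then show "commutator x x = \<zero>\<^bsub>n_alg n\<^esub>"
    by (auto simp: n_alg_simps commutator_def dest!: strictly_upper_mats_carrier)
next
  fix x y z assume "x \<in> carrier (n_alg n)" "y \<in> carrier (n_alg n)" "z \<in> carrier (n_alg n)"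
  then have c: "x \<in> carrier_mat n n" "y \<in> carrier_mat n n" "z \<in> carrier_mat n n"
    by (auto simp: n_alg_simps dest!: strictly_upper_mats_carrier)
  show "commutator x (commutator y z) \<oplus>\<^bsub>n_alg n\<^esub> commutator y (commutator z x)
      \<oplus>\<^bsub>n_alg n\<^esub> commutator z (commutator x y) = \<zero>\<^bsub>n_alg n\<^esub>"
    using commutator_jacobi[OF c] by (simp add: n_alg_simps)
next
  fix \<xi> assume "\<xi> \<in> carrier (n_alg n)"
  then have c: "\<xi> \<in> carrier_mat n n"
    by (auto simp: n_alg_simps dest!: strictly_upper_mats_carrier)
  show "linear_map class_ring (module_vec TYPE(complex) n) (module_vec TYPE(complex) n)
      (standard_rep \<xi>)"
    using c by (intro linear_mapI vec_vs)
      (auto simp: module_vec_simps standard_rep_def mult_add_distrib_mat_vec[of _ n n])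
next
  fix x assume "x \<in> carrier (module_vec TYPE(complex) n)"
  then show "linear_map class_ring (n_alg n) (module_vec TYPE(complex) n) (\<lambda>\<xi>. standard_rep \<xi> x)"
    by (intro linear_mapI vec_vs vectorspace_n_alg)
      (auto simp: module_vec_simps n_alg_simps standard_rep_def
        add_mult_distrib_mat_vec[of _ n n] dest!: strictly_upper_mats_carrier)
next
  fix \<xi> \<eta> x
  assume "\<xi> \<in> carrier (n_alg n)" "\<eta> \<in> carrier (n_alg n)"
    "x \<in> carrier (module_vec TYPE(complex) n)"
  then have c: "\<xi> \<in> carrier_mat n n" "\<eta> \<in> carrier_mat n n" "x \<in> carrier_vec n"
    by (auto simp: n_alg_simps module_vec_simps dest!: strictly_upper_mats_carrier)
  interpret V: vectorspace "class_ring :: complex ring" "module_vec TYPE(complex) n"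
    by (rule vec_vs)
  have "\<ominus>\<^bsub>module_vec TYPE(complex) n\<^esub> v = - v" if "v \<in> carrier_vec n" for v
    using that by (intro V.minus_equality) (auto simp: module_vec_simps)
  then have minus: "u \<ominus>\<^bsub>module_vec TYPE(complex) n\<^esub> v = u - v"
    if "u \<in> carrier_vec n" "v \<in> carrier_vec n" for u v
    using that by (simp add: a_minus_def module_vec_simps minus_add_uminus_vec)
  show "standard_rep (commutator \<xi> \<eta>) x = standard_rep \<xi> (standard_rep \<eta> x)
      \<ominus>\<^bsub>module_vec TYPE(complex) n\<^esub> standard_rep \<eta> (standard_rep \<xi> x)"
    using c by (simp add: standard_rep_def minus commutator_def minus_mult_distrib_mat_vec[of _ n n])
qed

end

(* In the basis E_ij (i < j) the map R_x sends E_ij to x_j e_i, so the pencil splits into the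
   1 x (n - i) pencils of the i-th rows. Generically the rows with n - i >= 2 are given by two
   linearly independent functionals, hence each is one horizontal block of width 2 and n - i - 2
   zero columns; row n - 1 is the 1 x 1 Jordan block with eigenvalue a_n / b_n; row n is zero.
   Indices below are 0-based and n = N + 2, so rows N and N + 1 are the last two. *)
theory Submission
  imports Defs
begin

section \<open>Linear functionals and dual bases\<close>

definition linear_functional :: "(complex, 'v) module \<Rightarrow> ('v \<Rightarrow> complex) \<Rightarrow> bool" where
  "linear_functional V f \<longleftrightarrow>
     (\<forall>x\<in>carrier V. \<forall>y\<in>carrier V. f (x \<oplus>\<^bsub>V\<^esub> y) = f x + f y) \<and>
     (\<forall>c. \<forall>x\<in>carrier V. f (c \<odot>\<^bsub>V\<^esub> x) = c * f x)"

lemma linear_functional_finsum: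
  assumes V: "vectorspace class_ring V" and f: "linear_functional V f"
    and "finite S" and "g \<in> S \<rightarrow> carrier V"
  shows "f (\<Oplus>\<^bsub>V\<^esub>i\<in>S. c i \<odot>\<^bsub>V\<^esub> g i) = (\<Sum>i\<in>S. c i * f (g i))"
proof -
  interpret vectorspace class_ring V by (rule V)
  have zero: "f \<zero>\<^bsub>V\<^esub> = 0"
    using f M.zero_closed M.l_zero unfolding linear_functional_def
    by (metis add_cancel_right_left)
  from \<open>finite S\<close> \<open>g \<in> S \<rightarrow> carrier V\<close> show ?thesis
  proof (induction S rule: finite_induct)
    case empty
    then show ?case by (simp add: zero)
  next
    case (insert i S)
    have 1: "(\<lambda>i. c i \<odot>\<^bsub>V\<^esub> g i) \<in> S \<rightarrow> carrier V" "c i \<odot>\<^bsub>V\<^esub> g i \<in> carrier V"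
      "g i \<in> carrier V" "g \<in> S \<rightarrow> carrier V"
      using insert.prems by (auto simp: class_ring_simps intro!: smult_closed)
    then have "f (c i \<odot>\<^bsub>V\<^esub> g i \<oplus>\<^bsub>V\<^esub> (\<Oplus>\<^bsub>V\<^esub>i\<in>S. c i \<odot>\<^bsub>V\<^esub> g i))
        = c i * f (g i) + f (\<Oplus>\<^bsub>V\<^esub>i\<in>S. c i \<odot>\<^bsub>V\<^esub> g i)"
      using f M.finsum_closed[OF 1(1)] unfolding linear_functional_def by auto
    then show ?case
      using insert 1 by (simp add: M.finsum_insert)
  qed
qed

text \<open>Applying \<open>\<phi> p\<close> to a linear relation isolates the coefficient of
  \<open>u p\<close>, so dual functionals give independence. The expansion formula gives spanning,
  and no dimension count is involved.\<close>

lemma ordered_basisI_dual: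
  assumes V: "vectorspace class_ring V" and "distinct ps"
    and carrier: "u \<in> set ps \<rightarrow> carrier V"
    and functional: "\<And>p. p \<in> set ps \<Longrightarrow> linear_functional V (\<phi> p)"
    and dual: "\<And>p q. p \<in> set ps \<Longrightarrow> q \<in> set ps \<Longrightarrow> \<phi> p (u q) = (if p = q then 1 else 0)"
    and expand: "\<And>x. x \<in> carrier V \<Longrightarrow> x = (\<Oplus>\<^bsub>V\<^esub>p\<in>set ps. \<phi> p x \<odot>\<^bsub>V\<^esub> u p)"
  shows "ordered_basis V (map u ps)"
proof -
  interpret vectorspace class_ring V by (rule V)
  have inj: "inj_on u (set ps)"
    by (rule inj_onI) (metis dual zero_neq_one)
  have sub: "u ` set ps \<subseteq> carrier V" using carrier by auto
  have "lin_indpt (u ` set ps)"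
  proof
    assume "lin_dep (u ` set ps)"
    then obtain S c v where S: "finite S" "S \<subseteq> u ` set ps" "lincomb c S = \<zero>\<^bsub>V\<^esub>"
      "v \<in> S" "c v \<noteq> 0"
      unfolding lin_dep_def by (auto simp: class_ring_simps)
    then obtain p where p: "p \<in> set ps" "v = u p" by auto
    have "\<phi> p w = (if w = v then 1 else 0)" if "w \<in> S" for w
      using that S(2) p dual inj by (auto simp: inj_on_def)
    then have "c v = (\<Sum>w\<in>S. c w * \<phi> p w)"
      using S(1,4) by (simp add: if_distrib[of "\<lambda>x. _ * x"] cong: if_cong)
    also have "\<dots> = \<phi> p (\<Oplus>\<^bsub>V\<^esub>w\<in>S. c w \<odot>\<^bsub>V\<^esub> w)"
      using S(1,2) sub p
        linear_functional_finsum[OF V functional[OF p(1)] S(1), of "\<lambda>w. w" c]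
      by fastforce
    also have "\<dots> = \<phi> p \<zero>\<^bsub>V\<^esub>"
      using S(3) by (simp add: lincomb_def)
    \<comment> \<open>The empty instance of the sum formula is the statement that a functional
      vanishes at the zero vector.\<close>
    also have "\<dots> = 0"
      using linear_functional_finsum[OF V functional[OF p(1)], of "{}"] by simp
    finally show False using S(5) by simp
  qed
  moreover have "span (u ` set ps) = carrier V"
  proof
    show "span (u ` set ps) \<subseteq> carrier V" by (rule span_is_subset2[OF sub])
    show "carrier V \<subseteq> span (u ` set ps)"
    proof
      fix x assume x: "x \<in> carrier V"
      \<comment> \<open>\<open>lincomb\<close> indexes coefficients by vectors, the expansion by
        labels; injectivity of \<open>u\<close> allows the change of index.\<close>
      let ?c = "\<lambda>v. \<phi> (inv_into (set ps) u v) x"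
      have "x = (\<Oplus>\<^bsub>V\<^esub>p\<in>set ps. ?c (u p) \<odot>\<^bsub>V\<^esub> u p)"
        using inj carrier
        by (subst expand[OF x])
          (intro M.finsum_cong', auto simp: class_ring_simps intro!: smult_closed)
      also have "\<dots> = lincomb ?c (u ` set ps)"
        unfolding lincomb_def using inj carrier
        by (subst M.finsum_reindex)
          (auto simp: class_ring_simps intro!: smult_closed)
      finally show "x \<in> span (u ` set ps)"
        unfolding span_def using x by (auto simp: class_ring_simps)
    qed
  qed
  ultimately show ?thesis
    using \<open>distinct ps\<close> inj sub
    by (simp add: ordered_basis_def basis_def distinct_map)
qed

lemma ordered_basis_unit_vecs:
  "ordered_basis (module_vec TYPE(complex) n) (map (unit_vec n) [0..<n])"
proof -
  interpret vec_space "TYPE(complex)" n .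
  show ?thesis
    using unit_vecs_basis unit_vecs_distinct
    by (simp add: ordered_basis_def unit_vecs_def)
qed


section \<open>Block-diagonal matrices of linear maps\<close>

lemma (in abelian_monoid) finsum_lessThan_add:
  fixes m n :: nat
  assumes "f \<in> {..<m + n} \<rightarrow> carrier G"
  shows "(\<Oplus>i\<in>{..<m + n}. f i) = (\<Oplus>i\<in>{..<m}. f i) \<oplus> (\<Oplus>i\<in>{..<n}. f (m + i))"
  using assms
proof (induction n)
  case 0
  then show ?case by (simp add: Pi_def)
next
  case (Suc n)
  then have 1: "f \<in> {..<m + n} \<rightarrow> carrier G" "f (m + n) \<in> carrier G" 
    "f \<in> {..<m} \<rightarrow> carrier G" "(\<lambda>i. f (m + i)) \<in> {..<n} \<rightarrow> carrier G"
    by (auto simp: Pi_def)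
  then show ?case
    using Suc.IH[OF 1(1)] by (simp add: lessThan_Suc finsum_insert a_ac)
qed

text \<open>The column sum splits at \<open>length vs\<close>. The zero off-diagonal blocks kill one
  half, and the other half is the column of \<open>M\<close> or of \<open>M'\<close>.\<close>

lemma is_matrix_of_four_block:
  assumes V: "vectorspace class_ring V" and carrier: "set vs \<subseteq> carrier V" "set vs' \<subseteq> carrier V"
    and M: "is_matrix_of V us vs f M" and M': "is_matrix_of V us' vs' f M'"
  shows "is_matrix_of V (us @ us') (vs @ vs') f
    (four_block_mat M (0\<^sub>m (dim_row M) (dim_col M')) (0\<^sub>m (dim_row M') (dim_col M)) M')"
    (is "is_matrix_of V _ _ f ?F")
  unfolding is_matrix_of_def
proof (intro conjI allI impI)
  interpret vectorspace class_ring V by (rule V)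
  have dims: "dim_row M = length vs" "dim_col M = length us"
    "dim_row M' = length vs'" "dim_col M' = length us'"
    using M M' by (auto simp: is_matrix_of_def)
  then show "?F \<in> carrier_mat (length (vs @ vs')) (length (us @ us'))" by auto
  fix j assume j: "j < length (us @ us')"
  have vs: "(vs @ vs') ! i \<in> carrier V" if "i < length (vs @ vs')" for i
    using that carrier nth_mem[of i "vs @ vs'"] by auto
  have zero: "0 \<odot>\<^bsub>V\<^esub> v = \<zero>\<^bsub>V\<^esub>" if "v \<in> carrier V" for v
    using lmult_0[OF that] by (simp add: class_ring_simps)
  have c1: "vs ! i \<in> carrier V" if "i < length vs" for i using that carrier by auto
  have c2: "vs' ! i \<in> carrier V" if "i < length vs'" for i using that carrier by auto
  have closed: "c \<odot>\<^bsub>V\<^esub> v \<in> carrier V" if "v \<in> carrier V" for c v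
    using smult_closed[of c v] that by (simp add: class_ring_simps)
  have "(\<Oplus>\<^bsub>V\<^esub>i\<in>{..<length (vs @ vs')}. ?F $$ (i, j) \<odot>\<^bsub>V\<^esub> ((vs @ vs') ! i)) =
     (\<Oplus>\<^bsub>V\<^esub>i\<in>{..<length vs}. ?F $$ (i, j) \<odot>\<^bsub>V\<^esub> ((vs @ vs') ! i)) \<oplus>\<^bsub>V\<^esub>
     (\<Oplus>\<^bsub>V\<^esub>i\<in>{..<length vs'}. ?F $$ (length vs + i, j) \<odot>\<^bsub>V\<^esub> ((vs @ vs') ! (length vs + i)))"
    unfolding length_append using vs by (intro M.finsum_lessThan_add) (auto intro!: closed)
  also have "(\<Oplus>\<^bsub>V\<^esub>i\<in>{..<length vs}. ?F $$ (i, j) \<odot>\<^bsub>V\<^esub> ((vs @ vs') ! i)) =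
    (if j < length us then f (us ! j) else \<zero>\<^bsub>V\<^esub>)"
  proof (cases "j < length us")
    case True
    then have "f (us ! j) = (\<Oplus>\<^bsub>V\<^esub>i\<in>{..<length vs}. M $$ (i, j) \<odot>\<^bsub>V\<^esub> (vs ! i))"
      using M by (simp add: is_matrix_of_def)
    also have "\<dots> = (\<Oplus>\<^bsub>V\<^esub>i\<in>{..<length vs}. ?F $$ (i, j) \<odot>\<^bsub>V\<^esub> ((vs @ vs') ! i))"
      using True j dims c1 by (intro M.finsum_cong') (auto simp: nth_append intro!: closed)
    finally show ?thesis using True by simp
  next
    case False
    have "(\<Oplus>\<^bsub>V\<^esub>i\<in>{..<length vs}. ?F $$ (i, j) \<odot>\<^bsub>V\<^esub> ((vs @ vs') ! i)) =
       (\<Oplus>\<^bsub>V\<^esub>i\<in>{..<length vs}. \<zero>\<^bsub>V\<^esub>)"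
      using False j dims c1 zero by (intro M.finsum_cong') (auto simp: nth_append)
    then show ?thesis using False M.finsum_zero by simp
  qed
  also have "(\<Oplus>\<^bsub>V\<^esub>i\<in>{..<length vs'}. ?F $$ (length vs + i, j) \<odot>\<^bsub>V\<^esub> ((vs @ vs') ! (length vs + i))) =
    (if j < length us then \<zero>\<^bsub>V\<^esub> else f (us' ! (j - length us)))"
  proof (cases "j < length us")
    case True
    have "(\<Oplus>\<^bsub>V\<^esub>i\<in>{..<length vs'}. ?F $$ (length vs + i, j) \<odot>\<^bsub>V\<^esub> ((vs @ vs') ! (length vs + i))) =
       (\<Oplus>\<^bsub>V\<^esub>i\<in>{..<length vs'}. \<zero>\<^bsub>V\<^esub>)"
      using True j dims c2 zero by (intro M.finsum_cong') (auto simp: nth_append)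
    then show ?thesis using True M.finsum_zero by simp
  next
    case False
    then have "f (us' ! (j - length us)) =
        (\<Oplus>\<^bsub>V\<^esub>i\<in>{..<length vs'}. M' $$ (i, j - length us) \<odot>\<^bsub>V\<^esub> (vs' ! i))"
      using M' j by (simp add: is_matrix_of_def)
    also have "\<dots> = (\<Oplus>\<^bsub>V\<^esub>i\<in>{..<length vs'}.
        ?F $$ (length vs + i, j) \<odot>\<^bsub>V\<^esub> ((vs @ vs') ! (length vs + i)))"
      using False j dims c2 by (intro M.finsum_cong') (auto simp: nth_append intro!: closed)
    finally show ?thesis using False by simp
  qed
  \<comment> \<open>Membership in the carrier is what permits dropping the zero summand of the
    vanishing half.\<close>
  moreover have "f ((us @ us') ! j) \<in> carrier V"
  proof (cases "j < length us")
    case True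
    then have "f (us ! j) = (\<Oplus>\<^bsub>V\<^esub>i\<in>{..<length vs}. M $$ (i, j) \<odot>\<^bsub>V\<^esub> (vs ! i))"
      using M by (simp add: is_matrix_of_def)
    then show ?thesis
      using True c1 by (auto simp: nth_append intro!: M.finsum_closed closed)
  next
    case False
    then have "f (us' ! (j - length us)) =
        (\<Oplus>\<^bsub>V\<^esub>i\<in>{..<length vs'}. M' $$ (i, j - length us) \<odot>\<^bsub>V\<^esub> (vs' ! i))"
      using M' j by (simp add: is_matrix_of_def)
    then show ?thesis
      using False c2 by (auto simp: nth_append intro!: M.finsum_closed closed)
  qed
  ultimately show "f ((us @ us') ! j) =
      (\<Oplus>\<^bsub>V\<^esub>i\<in>{..<length (vs @ vs')}. ?F $$ (i, j) \<odot>\<^bsub>V\<^esub> ((vs @ vs') ! i))"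
    by (auto simp: nth_append split: if_splits)
qed

text \<open>Each triple carries a block with its share of both bases. An empty share is allowed, so
  zero columns and zero rows need no separate treatment.\<close>

lemma is_matrix_of_diag_block:
  assumes V: "vectorspace class_ring V"
    and "\<And>us vs M. (us, vs, M) \<in> set ts \<Longrightarrow> set vs \<subseteq> carrier V \<and> is_matrix_of V us vs f M"
  shows "is_matrix_of V (concat (map fst ts)) (concat (map (fst \<circ> snd) ts)) f
    (diag_block_mat (map (snd \<circ> snd) ts))"
  using assms(2)
proof (induction ts)
  case Nil
  then show ?case by (simp add: is_matrix_of_def)
next
  case (Cons t ts)
  obtain us vs M where t: "t = (us, vs, M)" by (cases t)
  have "set (concat (map (fst \<circ> snd) ts)) \<subseteq> carrier V"
    using Cons.prems by force
  moreover have "set vs \<subseteq> carrier V" "is_matrix_of V us vs f M"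
    using Cons.prems t by auto
  moreover have "is_matrix_of V (concat (map fst ts)) (concat (map (fst \<circ> snd) ts)) f
      (diag_block_mat (map (snd \<circ> snd) ts))"
    using Cons.prems by (intro Cons.IH) (meson list.set_intros(2))
  ultimately show ?case
    using is_matrix_of_four_block[OF V, of vs _ us f M] t by (simp add: Let_def comp_def)
qed

lemma has_algebraic_type_diag_blockI:
  assumes "linear_map class_ring U V A" "linear_map class_ring U V B"
    and "ordered_basis U (concat (map fst ts))"
    and "ordered_basis V (concat (map (fst \<circ> snd) ts))"
    and "\<And>us vs k. (us, vs, k) \<in> set ts \<Longrightarrow> valid_block k \<and> set vs \<subseteq> carrier V \<and>
      is_matrix_of V us vs A (block_A k) \<and> is_matrix_of V us vs B (block_B k)"
  shows "has_algebraic_type U V A B (type_of_blocks (map (snd \<circ> snd) ts))"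
proof -
  have V: "vectorspace class_ring V" using assms(1) by (simp add: linear_map_def)
  \<comment> \<open>Stated for arbitrary \<open>f\<close> and \<open>block\<close>, to serve both
    \<open>A\<close> with \<open>block_A\<close> and \<open>B\<close> with
    \<open>block_B\<close>.\<close>
  have "is_matrix_of V (concat (map fst ts)) (concat (map (fst \<circ> snd) ts)) f
      (diag_block_mat (map block (map (snd \<circ> snd) ts)))"
    if "\<And>us vs k. (us, vs, k) \<in> set ts \<Longrightarrow> set vs \<subseteq> carrier V \<and> is_matrix_of V us vs f (block k)"
    for f block
    using is_matrix_of_diag_block[OF V, of "map (\<lambda>(us, vs, k). (us, vs, block k)) ts" f] that
    by (force simp: comp_def case_prod_unfold)
  moreover have "list_all valid_block (map (snd \<circ> snd) ts)"
    using assms(5) by (fastforce simp: list_all_iff)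
  ultimately show ?thesis
    unfolding has_algebraic_type_def using assms by blast
qed

section \<open>The pencil of a generic pair of vectors\<close>

lemma mult_mat_vec_nth:
  assumes "X \<in> carrier_mat m n" "x \<in> carrier_vec n" "i < m"
  shows "(X *\<^sub>v x) $ i = (\<Sum>j<n. X $$ (i, j) * x $ j)"
  using assms by (auto simp: scalar_prod_def lessThan_atLeast0 intro!: sum.cong)

lemma linear_functional_entry:
  assumes "i < n" "j < n"
  shows "linear_functional (n_alg n) (\<lambda>X. X $$ (i, j))"
  using assms
  by (auto simp: linear_functional_def n_alg_simps dest!: strictly_upper_mats_carrier)

lemma linear_functional_mult_vec_nth:
  assumes "i < n" "x \<in> carrier_vec n"
  shows "linear_functional (n_alg n) (\<lambda>X. (X *\<^sub>v x) $ i)"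
  using assms
  by (auto simp: linear_functional_def n_alg_simps mult_mat_vec_nth[of _ n n]
      sum.distrib sum_distrib_left algebra_simps
      dest!: strictly_upper_mats_carrier simp del: index_mult_mat_vec)

text \<open>\<open>b_last\<close> makes the Jordan eigenvalue finite. Every row above row
  \<open>N\<close> meets the last two columns, so the single condition \<open>minor\<close> makes
  \<open>a\<close> and \<open>b\<close> independent functionals on all of these rows at
  once.\<close>

locale generic_pair =
  fixes N :: nat and a b :: "complex vec"
  assumes a: "a \<in> carrier_vec (Suc (Suc N))" and b: "b \<in> carrier_vec (Suc (Suc N))"
    and b_last: "b $ Suc N \<noteq> 0"
    and minor: "a $ N * b $ Suc N - a $ Suc N * b $ N \<noteq> 0"
begin

abbreviation n where "n \<equiv> Suc (Suc N)"

section \<open>Basis matrices and their dual coordinates\<close>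

definition minor_ab where "minor_ab = a $ N * b $ Suc N - a $ Suc N * b $ N"

text \<open>On the span of the last two coordinates, \<open>r0, r1\<close> is the basis dual to \<open>b, a\<close>, viewed as
  linear functionals.\<close>

definition r0 :: "nat \<Rightarrow> complex" where
  "r0 j = (if j = N then - a $ Suc N / minor_ab else if j = Suc N then a $ N / minor_ab else 0)"

definition r1 :: "nat \<Rightarrow> complex" where
  "r1 j = (if j = N then b $ Suc N / minor_ab else if j = Suc N then - b $ N / minor_ab else 0)"

text \<open>In the last case the unit row at \<open>q\<close> is corrected by \<open>r0\<close> and
  \<open>r1\<close> so that it pairs to zero with both \<open>a\<close> and \<open>b\<close>; these
  rows span the common kernel. Row \<open>N\<close> has one free entry, scaled to pair to 1 with
  \<open>b\<close>.\<close>

definition row_basis :: "nat \<Rightarrow> nat \<Rightarrow> nat \<Rightarrow> complex" where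
  "row_basis i q j =
     (if i = N then if j = Suc N then 1 / b $ Suc N else 0
      else if q = N then r0 j
      else if q = Suc N then r1 j
      else (if j = q then 1 else 0) - b $ q * r0 j - a $ q * r1 j)"

definition mat_basis :: "nat \<times> nat \<Rightarrow> complex mat" where
  "mat_basis p = mat n n (\<lambda>(i, j). if i = fst p then row_basis (fst p) (snd p) j else 0)"

text \<open>The functionals dual to \<open>mat_basis\<close>: pairings with \<open>b\<close> and
  \<open>a\<close> detect \<open>r0\<close> and \<open>r1\<close> and vanish on kernel rows. An
  entry in a column before \<open>N\<close> detects a kernel row, since \<open>r0\<close> and
  \<open>r1\<close> vanish there.\<close>

definition coord :: "nat \<times> nat \<Rightarrow> complex mat \<Rightarrow> complex" where
  "coord p X =
     (if fst p = N \<or> snd p = N then (X *\<^sub>v b) $ fst p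
      else if snd p = Suc N then (X *\<^sub>v a) $ fst p
      else X $$ p)"

definition kernel_positions :: "(nat \<times> nat) list" where
  "kernel_positions = filter (\<lambda>(i, j). i < j) (List.product [0..<N] [0..<N])"

text \<open>The order is that of the blocks: the two labels of each width 2 block are adjacent, then
  comes the Jordan block, then the zero columns.\<close>

definition positions :: "(nat \<times> nat) list" where
  "positions = List.product [0..<N] [N, Suc N] @ [(N, Suc N)] @ kernel_positions"

lemma set_positions: "set positions = (SIGMA i:{..N}. {i<..Suc N})"
  by (auto simp: positions_def kernel_positions_def)

lemma distinct_positions: "distinct positions"
  by (auto simp: positions_def kernel_positions_def intro!: distinct_product distinct_filter)

lemma length_kernel_positions: "length kernel_positions = (N - 1) * N div 2"
proof -
  have "length kernel_positions = card (set kernel_positions)"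
    by (simp add: kernel_positions_def distinct_product distinct_card[symmetric])
  also have "set kernel_positions = (SIGMA i:{..<N}. {i<..<N})"
    by (auto simp: kernel_positions_def)
  also have "card \<dots> = (\<Sum>i<N. N - Suc i)"
    by (simp add: card_SigmaI)
  also have "\<dots> = (\<Sum>i<N. i)"
    by (rule sum.nat_diff_reindex)
  also have "\<dots> = (N - 1) * N div 2"
    by (simp add: lessThan_atLeast0 Sum_Ico_nat mult.commute)
  finally show ?thesis .
qed

section \<open>The action of the basis matrices on \<open>a\<close> and \<open>b\<close>\<close>

lemma mat_basis_carrier: "mat_basis p \<in> carrier_mat n n"
  by (simp add: mat_basis_def)

lemma mat_basis_strictly_upper:
  assumes "p \<in> set positions"
  shows "mat_basis p \<in> strictly_upper_mats n"
  using assms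
  by (auto simp: set_positions strictly_upper_mats_def mat_basis_def row_basis_def r0_def r1_def)

lemma minor_ab_nonzero: "minor_ab \<noteq> 0"
  using minor by (simp add: minor_ab_def)

text \<open>\<open>s0\<close> and \<open>s1\<close> are the pairings of \<open>r0\<close> and
  \<open>r1\<close> with \<open>f\<close>. A single closed form for arbitrary \<open>f\<close> is
  then specialised to \<open>a\<close> and to \<open>b\<close>.\<close>

lemma row_basis_sum:
  assumes "i \<le> N" "i < q" "q \<le> Suc N"
  shows "(\<Sum>j<n. row_basis i q j * f j) =
    (let s0 = (a $ N * f (Suc N) - a $ Suc N * f N) / minor_ab;
         s1 = (b $ Suc N * f N - b $ N * f (Suc N)) / minor_ab
     in if i = N then f (Suc N) / b $ Suc N else if q = N then s0 else if q = Suc N then s1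
        else f q - b $ q * s0 - a $ q * s1)"
proof -
  have *: "(\<Sum>j<N. (if j = q then 1 else 0) * f j) = f q"
    "(\<Sum>j<N. f j * (if j = q then 1 else 0)) = f q" if "q < N"
    using that by (simp_all add: if_distrib[of "\<lambda>x. x * _"] if_distrib[of "\<lambda>x. _ * x"] cong: if_cong)
  consider "i = N" "q = Suc N" | "i < N" "q = N" | "i < N" "q = Suc N" | "i < N" "q < N"
    using assms by linarith
  then show ?thesis
    using minor_ab_nonzero
    by cases (simp_all add: row_basis_def r0_def r1_def Let_def field_simps *)
qed

text \<open>For \<open>f = a\<close> one has \<open>s0 = 0\<close> and \<open>s1 = 1\<close>, so a
  kernel row gives \<open>a $ q - a $ q = 0\<close>.\<close>

lemma row_basis_a:
  assumes "i \<le> N" "i < q" "q \<le> Suc N"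
  shows "(\<Sum>j<n. row_basis i q j * a $ j) =
    (if i = N then a $ Suc N / b $ Suc N else if q = Suc N then 1 else 0)"
proof -
  have "a $ N * a $ Suc N - a $ Suc N * a $ N = 0"
    "b $ Suc N * a $ N - b $ N * a $ Suc N = minor_ab"
    by (simp_all add: minor_ab_def)
  then show ?thesis
    using assms minor_ab_nonzero by (simp add: row_basis_sum Let_def del: sum.lessThan_Suc)
qed

lemma row_basis_b:
  assumes "i \<le> N" "i < q" "q \<le> Suc N"
  shows "(\<Sum>j<n. row_basis i q j * b $ j) = (if i = N \<or> q = N then 1 else 0)"
proof -
  have "a $ N * b $ Suc N - a $ Suc N * b $ N = minor_ab"
    "b $ Suc N * b $ N - b $ N * b $ Suc N = 0"
    by (simp_all add: minor_ab_def)
  then show ?thesis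
    using assms b_last minor_ab_nonzero
    by (simp add: row_basis_sum Let_def del: sum.lessThan_Suc)
qed

lemma mat_basis_mult_vec_nth:
  assumes "x \<in> carrier_vec n" "r < n"
  shows "(mat_basis (i, q) *\<^sub>v x) $ r = (if r = i then (\<Sum>j<n. row_basis i q j * x $ j) else 0)"
  unfolding mult_mat_vec_nth[OF mat_basis_carrier assms]
  using assms by (simp add: mat_basis_def del: sum.lessThan_Suc)

text \<open>Together with \<open>mat_basis_b\<close> this yields the block entries: the labels
  \<open>(i, N)\<close> and \<open>(i, Suc N)\<close> with \<open>i < N\<close> give the rows (0 1)
  for \<open>a\<close> and (1 0) for \<open>b\<close>, and \<open>(N, Suc N)\<close> gives the
  eigenvalue and 1.\<close>

lemma mat_basis_a:
  assumes "(i, q) \<in> set positions"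
  shows "mat_basis (i, q) *\<^sub>v a =
    (if i = N then a $ Suc N / b $ Suc N else if q = Suc N then 1 else 0) \<cdot>\<^sub>v unit_vec n i"
  using assms a row_basis_a[of i q] mat_basis_carrier[of "(i, q)"]
  by (intro eq_vecI)
    (auto simp: mat_basis_mult_vec_nth set_positions simp del: sum.lessThan_Suc index_mult_mat_vec)

lemma mat_basis_b:
  assumes "(i, q) \<in> set positions"
  shows "mat_basis (i, q) *\<^sub>v b = (if i = N \<or> q = N then 1 else 0) \<cdot>\<^sub>v unit_vec n i"
  using assms b row_basis_b[of i q] mat_basis_carrier[of "(i, q)"]
  by (intro eq_vecI)
    (auto simp: mat_basis_mult_vec_nth set_positions simp del: sum.lessThan_Suc index_mult_mat_vec)

section \<open>Duality, expansion and the resulting basis of the Lie algebra\<close>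

lemma coord_mat_basis:
  assumes "p \<in> set positions" "p' \<in> set positions"
  shows "coord p (mat_basis p') = (if p = p' then 1 else 0)"
proof -
  obtain i q i' q' where p: "p = (i, q)" "p' = (i', q')" by (cases p, cases p')
  then show ?thesis
    using assms mat_basis_a[of i' q'] mat_basis_b[of i' q']
    by (auto simp: coord_def set_positions mat_basis_def row_basis_def r0_def r1_def
        simp del: index_mult_mat_vec)
qed

lemma linear_functional_coord:
  assumes "p \<in> set positions"
  shows "linear_functional (n_alg n) (coord p)"
proof -
  obtain i q where p: "p = (i, q)" "i < n" "q < n"
    using assms by (auto simp: set_positions)
  have "coord p = (if i = N \<or> q = N then (\<lambda>X. (X *\<^sub>v b) $ i)
      else if q = Suc N then (\<lambda>X. (X *\<^sub>v a) $ i) else (\<lambda>X. X $$ (i, q)))"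
    by (auto simp: coord_def p(1) simp del: index_mult_mat_vec)
  then show ?thesis
    using linear_functional_entry[OF p(2,3)] linear_functional_mult_vec_nth[OF p(2) a]
      linear_functional_mult_vec_nth[OF p(2) b]
    by (simp del: index_mult_mat_vec)
qed

text \<open>In a row above \<open>N\<close>, the corrections in the kernel rows cancel the
  contribution of the columns before \<open>N\<close> to the pairings with \<open>a\<close> and
  \<open>b\<close>. What remains is the expansion of the last two entries in the dual basis
  \<open>r0\<close>, \<open>r1\<close>.\<close>

lemma coord_expansion_entry:
  assumes X: "X \<in> strictly_upper_mats n" and r: "r < n" and s: "s < n"
  shows "(\<Sum>p\<in>set positions. coord p X * mat_basis p $$ (r, s)) = X $$ (r, s)"
proof -
  have Xc: "X \<in> carrier_mat n n" and X0: "\<And>j. j \<le> r \<Longrightarrow> X $$ (r, j) = 0"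
    using X r by (auto simp: strictly_upper_mats_def)
  have Xa: "(X *\<^sub>v a) $ r = (\<Sum>j<n. X $$ (r, j) * a $ j)"
    and Xb: "(X *\<^sub>v b) $ r = (\<Sum>j<n. X $$ (r, j) * b $ j)"
    by (rule mult_mat_vec_nth[OF Xc a r] mult_mat_vec_nth[OF Xc b r])+
  have "(\<Sum>p\<in>set positions. coord p X * mat_basis p $$ (r, s)) =
      (\<Sum>i\<le>N. \<Sum>q\<in>{i<..Suc N}. coord (i, q) X * mat_basis (i, q) $$ (r, s))"
    unfolding set_positions by (subst sum.Sigma) (auto simp: case_prod_unfold)
  \<comment> \<open>\<open>mat_basis (i, q)\<close> is supported in row \<open>i\<close>, so only
    \<open>i = r\<close> contributes.\<close>
  also have "\<dots> = (\<Sum>i\<le>N. if i = r then \<Sum>q\<in>{r<..Suc N}. coord (r, q) X * row_basis r q s else 0)"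
    using r s by (intro sum.cong) (auto simp: mat_basis_def)
  also have "\<dots> = (if r \<le> N then \<Sum>q\<in>{r<..Suc N}. coord (r, q) X * row_basis r q s else 0)"
    by simp
  also have "\<dots> = X $$ (r, s)"
  proof -
    consider "r = Suc N" | "r = N" | "r < N" using r by linarith
    then show ?thesis
    proof cases
      case 1
      then show ?thesis using X0 s by simp
    next
      case 2
      then have "{r<..Suc N} = {Suc N}" by auto
      moreover have "(\<Sum>j<N. X $$ (N, j) * b $ j) = 0"
        using X0 2 by (intro sum.neutral) auto
      ultimately show ?thesis
        using 2 s X0 b_last Xb by (auto simp: coord_def row_basis_def less_Suc_eq)
    next
      case 3
      have "{r<..Suc N} = insert (Suc N) (insert N {r<..<N})" using 3 by auto
      then have "(\<Sum>q\<in>{r<..Suc N}. coord (r, q) X * row_basis r q s) =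
          (X *\<^sub>v b) $ r * r0 s + (X *\<^sub>v a) $ r * r1 s
          + (\<Sum>q\<in>{r<..<N}. X $$ (r, q) * ((if s = q then 1 else 0) - b $ q * r0 s - a $ q * r1 s))"
        using 3 by (simp add: coord_def row_basis_def del: index_mult_mat_vec)
      \<comment> \<open>Entries on or left of the diagonal vanish, so the range can be enlarged to
        match the full sums in \<open>Xa\<close> and \<open>Xb\<close>.\<close>
      also have "(\<Sum>q\<in>{r<..<N}. X $$ (r, q) * ((if s = q then 1 else 0) - b $ q * r0 s - a $ q * r1 s))
          = (\<Sum>q<N. X $$ (r, q) * ((if s = q then 1 else 0) - b $ q * r0 s - a $ q * r1 s))"
        using X0 by (intro sum.mono_neutral_left) auto
      also have "\<dots> = (\<Sum>q<N. (if s = q then X $$ (r, q) else 0) - X $$ (r, q) * b $ q * r0 s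
          - X $$ (r, q) * a $ q * r1 s)"
        by (intro sum.cong) (auto simp: algebra_simps)
      also have "\<dots> = (if s < N then X $$ (r, s) else 0) - (\<Sum>q<N. X $$ (r, q) * b $ q) * r0 s
          - (\<Sum>q<N. X $$ (r, q) * a $ q) * r1 s"
        by (simp add: sum_subtractf sum_distrib_right)
      \<comment> \<open>The partial sums over \<open>q < N\<close> cancel, leaving only columns
        \<open>N\<close> and \<open>Suc N\<close> in the coefficients of \<open>r0\<close> and
        \<open>r1\<close>.\<close>
      also have "(X *\<^sub>v b) $ r * r0 s + (X *\<^sub>v a) $ r * r1 s + \<dots> =
          (if s < N then X $$ (r, s) else 0)
          + (X $$ (r, N) * b $ N + X $$ (r, Suc N) * b $ Suc N) * r0 s
          + (X $$ (r, N) * a $ N + X $$ (r, Suc N) * a $ Suc N) * r1 s"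
        unfolding Xa Xb by (simp add: algebra_simps)
      also have "\<dots> = X $$ (r, s)"
      proof -
        consider "s < N" | "s = N" | "s = Suc N" using s by linarith
        then show ?thesis
          using minor
          by cases (simp_all add: r0_def r1_def minor_ab_def divide_simps,
            simp_all add: algebra_simps)
      qed
      finally show ?thesis using 3 by simp
    qed
  qed
  finally show ?thesis .
qed

lemma ordered_basis_mat_basis: "ordered_basis (n_alg n) (map mat_basis positions)"
proof (rule ordered_basisI_dual[OF vectorspace_n_alg distinct_positions])
  interpret U: vectorspace class_ring "n_alg n" by (rule vectorspace_n_alg)
  show mb: "mat_basis \<in> set positions \<rightarrow> carrier (n_alg n)"
    by (simp add: n_alg_simps mat_basis_strictly_upper)
  fix X assume X: "X \<in> carrier (n_alg n)"
  let ?Y = "\<Oplus>\<^bsub>n_alg n\<^esub>p\<in>set positions. coord p X \<odot>\<^bsub>n_alg n\<^esub> mat_basis p"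
  have "?Y \<in> carrier (n_alg n)"
    using mb by (intro U.M.finsum_closed) (auto simp: class_ring_simps intro!: U.smult_closed)
  then have "?Y \<in> carrier_mat n n" "X \<in> carrier_mat n n"
    using X by (auto simp: n_alg_simps dest: strictly_upper_mats_carrier)
  \<comment> \<open>Taking an entry is a linear functional, so it passes through the abstract
    sum.\<close>
  moreover have "X $$ (r, s) = ?Y $$ (r, s)" if "r < n" "s < n" for r s
    using linear_functional_finsum[OF vectorspace_n_alg linear_functional_entry[OF that] _ mb]
      coord_expansion_entry[OF _ that] X
    by (simp add: n_alg_simps)
  ultimately show "X = ?Y" by (intro eq_matI) auto
qed (auto simp: linear_functional_coord coord_mat_basis)

section \<open>The Kronecker blocks of the pencil\<close>

lemma is_matrix_of_unit_vec:
  assumes "M \<in> carrier_mat 1 (length us)" "i < n"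
    and "\<And>j. j < length us \<Longrightarrow> f (us ! j) = M $$ (0, j) \<cdot>\<^sub>v unit_vec n i"
  shows "is_matrix_of (module_vec TYPE(complex) n) us [unit_vec n i] f M"
proof -
  interpret V: vectorspace class_ring "module_vec TYPE(complex) n" by (rule vec_vs)
  have "(\<Oplus>\<^bsub>module_vec TYPE(complex) n\<^esub>k\<in>{..<Suc 0}.
      M $$ (k, j) \<odot>\<^bsub>module_vec TYPE(complex) n\<^esub> [unit_vec n i] ! k)
      = M $$ (0, j) \<cdot>\<^sub>v unit_vec n i" for j
    by (simp add: lessThan_Suc V.M.finsum_insert module_vec_simps)
  then show ?thesis using assms by (simp add: is_matrix_of_def)
qed

lemma is_matrix_of_no_rows:
  assumes "M \<in> carrier_mat 0 (length us)" "\<And>u. u \<in> set us \<Longrightarrow> f u = 0\<^sub>v n"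
  shows "is_matrix_of (module_vec TYPE(complex) n) us [] f M"
proof -
  interpret V: vectorspace class_ring "module_vec TYPE(complex) n" by (rule vec_vs)
  show ?thesis using assms by (simp add: is_matrix_of_def module_vec_simps)
qed

text \<open>No basis matrix reaches the last unit vector, whence the vertical block. Width 1 blocks
  use no target vector, so listing them last leaves the unit vectors in their natural order.\<close>

definition blocks :: "(complex mat list \<times> complex vec list \<times> kronecker_block) list" where
  "blocks =
     map (\<lambda>i. ([mat_basis (i, N), mat_basis (i, Suc N)], [unit_vec n i], Horizontal 2)) [0..<N] @
     [([mat_basis (N, Suc N)], [unit_vec n N], Jordan (Some (a $ Suc N / b $ Suc N)) 1),
      ([], [unit_vec n (Suc N)], Vertical 1)] @
     map (\<lambda>p. ([mat_basis p], [], Horizontal 1)) kernel_positions"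

lemma concat_fst_blocks: "concat (map fst blocks) = map mat_basis positions"
  by (simp add: blocks_def positions_def comp_def product_concat_map map_concat)

lemma concat_fst_snd_blocks: "concat (map (fst \<circ> snd) blocks) = map (unit_vec n) [0..<n]"
  by (simp add: blocks_def comp_def)

lemma type_of_blocks_blocks:
  "type_of_blocks (map (snd \<circ> snd) blocks) =
     \<lparr>jordan_sizes = {#{#1#}#},
      horizontal_indices = replicate_mset ((N - 1) * N div 2) 1 + replicate_mset N 2,
      vertical_indices = {#1#}\<rparr>"
proof -
  have "map (snd \<circ> snd) blocks = replicate N (Horizontal 2) @
      [Jordan (Some (a $ Suc N / b $ Suc N)) 1, Vertical 1] @
      replicate ((N - 1) * N div 2) (Horizontal 1)"
    by (simp add: blocks_def comp_def map_replicate_const length_kernel_positions)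
  \<comment> \<open>There is exactly one eigenvalue, so the outer multiset of
    \<open>jordan_sizes\<close> is a singleton.\<close>
  moreover have "{e. \<exists>k. Jordan e k \<in> set (replicate N (Horizontal 2) @ [Jordan c 1, Vertical 1] @
      replicate K (Horizontal 1))} = {c}" for c K
    by auto
  moreover have "[h. Horizontal h \<leftarrow> replicate K (Horizontal m)] = replicate K m"
    "[h. Vertical h \<leftarrow> replicate K (Horizontal m)] = []"
    "[k. Jordan e' k \<leftarrow> replicate K (Horizontal m), e' = e] = []" for K m e
    by (induction K) auto
  ultimately show ?thesis
    by (simp add: type_of_blocks_def)
qed

lemma blocks_matrices:
  assumes "(us, vs, k) \<in> set blocks"
  shows "valid_block k \<and> set vs \<subseteq> carrier (module_vec TYPE(complex) n) \<and>
    is_matrix_of (module_vec TYPE(complex) n) us vs (R_map standard_rep a) (block_A k) \<and>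
    is_matrix_of (module_vec TYPE(complex) n) us vs (R_map standard_rep b) (block_B k)"
proof -
  note defs = R_map_def standard_rep_def zero_id_mat_def id_zero_mat_def jordan_block_def
  consider i where "i < N" "us = [mat_basis (i, N), mat_basis (i, Suc N)]" "vs = [unit_vec n i]"
      "k = Horizontal 2"
    | "us = [mat_basis (N, Suc N)]" "vs = [unit_vec n N]"
      "k = Jordan (Some (a $ Suc N / b $ Suc N)) 1"
    | "us = []" "vs = [unit_vec n (Suc N)]" "k = Vertical 1"
    | p where "p \<in> set kernel_positions" "us = [mat_basis p]" "vs = []" "k = Horizontal 1"
    using assms by (auto simp: blocks_def)
  then show ?thesis
  proof cases
    case 1
    then have "(i, N) \<in> set positions" "(i, Suc N) \<in> set positions"
      by (auto simp: set_positions)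
    note act = this[THEN mat_basis_a] this[THEN mat_basis_b]
    show ?thesis
      using 1 act
      by (auto simp: module_vec_simps defs less_Suc_eq numeral_2_eq_2
          intro!: is_matrix_of_unit_vec)
  next
    case 2
    then have "(N, Suc N) \<in> set positions" by (auto simp: set_positions)
    note act = this[THEN mat_basis_a] this[THEN mat_basis_b]
    show ?thesis
      using 2 act by (auto simp: module_vec_simps defs intro!: is_matrix_of_unit_vec)
  \<comment> \<open>The vertical block of height 1 has no columns, so the matrix condition is
    vacuous apart from the dimensions.\<close>
  next
    case 3
    then show ?thesis
      by (auto simp: module_vec_simps defs intro!: is_matrix_of_unit_vec)
  next
    case 4
    then obtain i q where p: "p = (i, q)" "i < N" "q < N" "p \<in> set positions"
      by (auto simp: kernel_positions_def set_positions)
    then show ?thesis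
      using 4 mat_basis_a[of i q] mat_basis_b[of i q]
      by (auto simp: defs intro!: is_matrix_of_no_rows)
  qed
qed

lemma has_algebraic_type_standard:
  "has_algebraic_type (n_alg n) (module_vec TYPE(complex) n)
     (R_map standard_rep a) (R_map standard_rep b)
     \<lparr>jordan_sizes = {#{#1#}#},
      horizontal_indices = replicate_mset ((N - 1) * N div 2) 1 + replicate_mset N 2,
      vertical_indices = {#1#}\<rparr>"
proof -
  \<comment> \<open>The representation supplies the linearity of \<open>R_map standard_rep a\<close>
    and \<open>R_map standard_rep b\<close>.\<close>
  interpret lie_representation "n_alg n" commutator "module_vec TYPE(complex) n" standard_rep
    by (rule lie_representation_standard)
  show ?thesis
    unfolding type_of_blocks_blocks[symmetric]
    using a b ordered_basis_mat_basis ordered_basis_unit_vecs[of n] blocks_matrices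
    by (intro has_algebraic_type_diag_blockI)
      (auto simp: R_map_def concat_fst_blocks concat_fst_snd_blocks module_vec_simps
        simp del: upt_Suc intro!: \<rho>_linear_arg)
qed

end

section \<open>Genericity and the final count\<close>

lemma polynomial_functions_entry:
  assumes "i < n"
  shows "(\<lambda>(a, b). a $ i) \<in>
      polynomial_functions (direct_sum (module_vec TYPE(complex) n) (module_vec TYPE(complex) n))"
    and "(\<lambda>(a, b). b $ i) \<in>
      polynomial_functions (direct_sum (module_vec TYPE(complex) n) (module_vec TYPE(complex) n))"
  using assms
  by (auto intro!: polynomial_functions.linear simp: direct_sum_def module_vec_simps)

text \<open>A single polynomial defines a principal open set, and the point \<open>x\<close> shows
  that it is non-empty.\<close>

lemma holds_generically_nonzeroI:
  assumes "p \<in> polynomial_functions W" "x \<in> carrier W" "p x \<noteq> 0"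
    and "\<And>y. y \<in> carrier W \<Longrightarrow> p y \<noteq> 0 \<Longrightarrow> Q y"
  shows "holds_generically W Q"
proof -
  have "zariski_open W {y \<in> carrier W. \<exists>q\<in>{p}. q y \<noteq> 0}"
    unfolding zariski_open_def using assms(1) by blast
  then show ?thesis
    unfolding holds_generically_def using assms(2-4) by (intro exI conjI) auto
qed

lemma has_JK_invariants_standard:
  "has_JK_invariants (n_alg (Suc (Suc N))) (module_vec TYPE(complex) (Suc (Suc N))) standard_rep
     \<lparr>jordan_sizes = {#{#1#}#},
      horizontal_indices = replicate_mset ((N - 1) * N div 2) 1 + replicate_mset N 2,
      vertical_indices = {#1#}\<rparr>"
proof -
  let ?n = "Suc (Suc N)"
  let ?W = "direct_sum (module_vec TYPE(complex) ?n) (module_vec TYPE(complex) ?n)"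
  let ?A = "\<lambda>i (a :: complex vec, b :: complex vec). a $ i"
  let ?B = "\<lambda>i (a :: complex vec, b :: complex vec). b $ i"
  \<comment> \<open>The product of the two quantities required to be non-zero in
    \<open>generic_pair\<close>. The difference is written with the factor -1 to fit the generating
    clauses of \<open>polynomial_functions\<close>.\<close>
  let ?p = "\<lambda>x. ?B (Suc N) x * (?A N x * ?B (Suc N) x + (- 1) * (?A (Suc N) x * ?B N x))"
  have "?p \<in> polynomial_functions ?W"
    by (intro polynomial_functions.mult polynomial_functions.add polynomial_functions.const
        polynomial_functions_entry) simp_all
  \<comment> \<open>For these two unit vectors both the last entry of \<open>b\<close> and the minor
    equal 1.\<close>
  moreover have "(unit_vec ?n N, unit_vec ?n (Suc N)) \<in> carrier ?W"
    by (simp add: direct_sum_def module_vec_simps)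
  moreover have "?p (unit_vec ?n N, unit_vec ?n (Suc N)) \<noteq> 0"
    by simp
  ultimately show ?thesis
    unfolding has_JK_invariants_def
  proof (rule holds_generically_nonzeroI)
    fix x assume x: "x \<in> carrier ?W" "?p x \<noteq> 0"
    obtain a b where ab: "x = (a, b)" by (cases x)
    interpret generic_pair N a b
      by unfold_locales (use x in \<open>auto simp: ab direct_sum_def module_vec_simps\<close>)
    show "case x of (a, b) \<Rightarrow> has_algebraic_type (n_alg ?n) (module_vec TYPE(complex) ?n)
        (R_map standard_rep a) (R_map standard_rep b)
        \<lparr>jordan_sizes = {#{#1#}#},
         horizontal_indices = replicate_mset ((N - 1) * N div 2) 1 + replicate_mset N 2,
         vertical_indices = {#1#}\<rparr>"
      using has_algebraic_type_standard by (simp add: ab)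
  qed
qed

theorem theorem3p42:
  fixes n :: nat
  assumes "n \<ge> 2"
  shows "let T = \<lparr>jordan_sizes = {#{#1#}#},
                  horizontal_indices =
                    replicate_mset ((n - 3) * (n - 2) div 2) 1 + replicate_mset (n - 2) 2,
                  vertical_indices = {#1#}\<rparr>
         in has_JK_invariants (n_alg n) (module_vec TYPE(complex) n) standard_rep T \<and>
            size (horizontal_indices T) = (n - 1) * (n - 2) div 2"
proof -
  \<comment> \<open>Here \<open>n - 3\<close> becomes \<open>N - 1\<close>. Truncation at
    \<open>n = 2\<close> is harmless because the other factor \<open>n - 2\<close> is then
    0.\<close>
  obtain N where n: "n = Suc (Suc N)"
    using assms by (metis add_2_eq_Suc le_Suc_ex)
  have "(N - 1) * N div 2 + N = Suc N * N div 2"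
    by (cases N) simp_all
  then show ?thesis
    using has_JK_invariants_standard[of N] by (simp add: n Let_def numeral_3_eq_3)
qed

end
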